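(* Let $\pi_s=\pi_{\theta'}$. The unique optimal policy that minimizes $\hat{\mathcal L}_{\mathrm{GVPO}}(\theta)$, defined as $$\hat{\mathcal L}_{\mathrm{GVPO}}(\theta)=\mathbb{E}_{x\sim\mathcal D}\,\mathbb{E}_{y\sim\pi_s(\cdot|x)}\Big[\big(R_\theta(x,y)-\mathbb{E}_{y\sim\pi_s}R_\theta(x,y)\big)-\big(R(x,y)-\mathbb{E}_{y\sim\pi_s}R(x,y)\big)\Big]^2 ,$$ is given by $$\pi_\theta(y|x)=\pi^*(y|x)=\frac{1}{Z(x)}\,\pi_{\theta'}(y|x)\,e^{R(x,y)/\beta}.$$
   Context: A (large language model) policy $\pi$ takes a prompt $x$ and generates a response $y$; $\pi(y|x)$ denotes the probability of generating $y$ from $x$. $\mathcal D$ is the distribution of prompts. $R(x,y)$ is a reward model scoring the response $y$ as a reply to the prompt $x$. $\beta>0$ is a constant, $\pi_{\theta'}$ is a given policy (the one relative to which the KL divergence is penalized), $\pi_\theta$ is the policy being optimized, and $\pi_s$ is the distribution from which responses are sampled. The partition function is $Z(x)=\sum_y\pi_{\theta'}(y|x)e^{R(x,y)/\beta}$, and the implicit reward of $\pi_\theta$ is $R_\theta(x,y)=\beta\log\frac{\pi_\theta(y|x)}{\pi_{\theta'}(y|x)}+\beta\log Z(x)$. The inner expectations $\mathbb{E}_{y\sim\pi_s}$ are over $y\sim\pi_s(\cdot|x)$ for the given $x$. The policy $\pi^*$ is the optimal solution of the KL-constrained reward maximization problem $\max_{\pi_\theta}\mathbb{E}_{x\sim\mathcal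 D,\,y\sim\pi_\theta(y|x)}[R(x,y)]-\beta\,\mathbb{D}_{KL}[\pi_\theta(y|x)\,\|\,\pi_{\theta'}(y|x)]$. *)

theory Defs
  imports "HOL-Probability.Probability"
begin

text \<open>
  Prompts have type \<open>'x\<close>, responses type \<open>'y\<close>, and a policy \<open>\<pi>(y|x)\<close> is a function
  \<open>\<pi> :: 'x \<Rightarrow> 'y pmf\<close>. Throughout, \<open>ref\<close> is \<open>\<pi>\<^sub>\<theta>\<^sub>'\<close>, \<open>s\<close> is the sampling distribution \<open>\<pi>\<^sub>s\<close>,
  and \<open>\<pi>\<close> is the policy \<open>\<pi>\<^sub>\<theta>\<close> being optimized.
\<close>

definition partition_fn ::
  "('x \<Rightarrow> 'y pmf) \<Rightarrow> ('x \<Rightarrow> 'y \<Rightarrow> real) \<Rightarrow> real \<Rightarrow> 'x \<Rightarrow> real" where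
  "partition_fn ref R \<beta> x = (\<Sum>\<^sub>\<infinity>y. pmf (ref x) y * exp (R x y / \<beta>))"

definition implicit_reward ::
  "('x \<Rightarrow> 'y pmf) \<Rightarrow> ('x \<Rightarrow> 'y \<Rightarrow> real) \<Rightarrow> real \<Rightarrow> ('x \<Rightarrow> 'y pmf) \<Rightarrow> 'x \<Rightarrow> 'y \<Rightarrow> real" where
  "implicit_reward ref R \<beta> \<pi> x y =
     \<beta> * ln (pmf (\<pi> x) y / pmf (ref x) y) + \<beta> * ln (partition_fn ref R \<beta> x)"

text \<open>
  Candidate policies are those with \<open>\<pi>(\<cdot>|x) \<lless> ref(\<cdot>|x)\<close> at every prompt that occurs, as is
  implicit in the density ratio \<open>\<pi>(y|x) / ref(y|x)\<close>. If \<open>ref\<close> has full support (as a softmax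
  model does), every policy is a candidate.
\<close>

definition candidate_policy :: "'x pmf \<Rightarrow> ('x \<Rightarrow> 'y pmf) \<Rightarrow> ('x \<Rightarrow> 'y pmf) \<Rightarrow> bool" where
  "candidate_policy D ref \<pi> \<longleftrightarrow> (\<forall>x\<in>set_pmf D. set_pmf (\<pi> x) \<subseteq> set_pmf (ref x))"

text \<open>
  The implicit reward has a finite mean under \<open>s\<close>. The first conjunct is needed because
  \<open>ln 0 = 0\<close> in HOL, whereas the implicit reward is \<open>-\<infinity>\<close> at a response with \<open>\<pi>(y|x) = 0\<close>.
\<close>

definition implicit_reward_mean_finite ::
  "'x pmf \<Rightarrow> ('x \<Rightarrow> 'y pmf) \<Rightarrow> ('x \<Rightarrow> 'y pmf) \<Rightarrow> ('x \<Rightarrow> 'y \<Rightarrow> real) \<Rightarrow> real \<Rightarrow> ('x \<Rightarrow> 'y pmf) \<Rightarrow> bool"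
where
  "implicit_reward_mean_finite D s ref R \<beta> \<pi> \<longleftrightarrow>
     (\<forall>x\<in>set_pmf D. set_pmf (s x) \<subseteq> set_pmf (\<pi> x) \<and>
        integrable (measure_pmf (s x)) (implicit_reward ref R \<beta> \<pi> x))"

text \<open>
  The loss takes values in \<open>[0, \<infinity>]\<close>. It is \<open>\<infinity>\<close> when the inner mean of the implicit reward is
  not finite; Bochner integrals of non-integrable functions are \<open>0\<close> in HOL, so the formula
  alone would be wrong there.
\<close>

definition gvpo_loss ::
  "'x pmf \<Rightarrow> ('x \<Rightarrow> 'y pmf) \<Rightarrow> ('x \<Rightarrow> 'y pmf) \<Rightarrow> ('x \<Rightarrow> 'y \<Rightarrow> real) \<Rightarrow> real \<Rightarrow> ('x \<Rightarrow> 'y pmf) \<Rightarrow> ennreal"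
where
  "gvpo_loss D s ref R \<beta> \<pi> =
     (if implicit_reward_mean_finite D s ref R \<beta> \<pi> then
        \<integral>\<^sup>+x. \<integral>\<^sup>+y. ennreal
          (((implicit_reward ref R \<beta> \<pi> x y
               - measure_pmf.expectation (s x) (implicit_reward ref R \<beta> \<pi> x))
            - (R x y - measure_pmf.expectation (s x) (R x)))\<^sup>2)
          \<partial>measure_pmf (s x) \<partial>measure_pmf D
      else \<infinity>)"

text \<open>
  Note the argument order of the library: \<open>KL_divergence b M N\<close> is the divergence of \<open>N\<close>
  from \<open>M\<close>, that is, \<open>D(N \<parallel> M)\<close>.
\<close>

definition kl_value ::
  "('x \<Rightarrow> 'y pmf) \<Rightarrow> ('x \<Rightarrow> 'y \<Rightarrow> real) \<Rightarrow> real \<Rightarrow> ('x \<Rightarrow> 'y pmf) \<Rightarrow> 'x \<Rightarrow> real" where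
  "kl_value ref R \<beta> \<pi> x =
     measure_pmf.expectation (\<pi> x) (R x)
     - \<beta> * KL_divergence (exp 1) (measure_pmf (ref x)) (measure_pmf (\<pi> x))"

definition kl_objective ::
  "'x pmf \<Rightarrow> ('x \<Rightarrow> 'y pmf) \<Rightarrow> ('x \<Rightarrow> 'y \<Rightarrow> real) \<Rightarrow> real \<Rightarrow> ('x \<Rightarrow> 'y pmf) \<Rightarrow> real" where
  "kl_objective D ref R \<beta> \<pi> = measure_pmf.expectation D (kl_value ref R \<beta> \<pi>)"

text \<open>The policies at which the objective is well defined and finite.\<close>

definition kl_feasible ::
  "'x pmf \<Rightarrow> ('x \<Rightarrow> 'y pmf) \<Rightarrow> ('x \<Rightarrow> 'y \<Rightarrow> real) \<Rightarrow> real \<Rightarrow> ('x \<Rightarrow> 'y pmf) \<Rightarrow> bool" where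
  "kl_feasible D ref R \<beta> \<pi> \<longleftrightarrow>
     candidate_policy D ref \<pi> \<and>
     (\<forall>x\<in>set_pmf D. integrable (measure_pmf (\<pi> x)) (R x) \<and>
        integrable (measure_pmf (\<pi> x))
          (entropy_density (exp 1) (measure_pmf (ref x)) (measure_pmf (\<pi> x)))) \<and>
     integrable (measure_pmf D) (kl_value ref R \<beta> \<pi>)"

definition kl_optimal ::
  "'x pmf \<Rightarrow> ('x \<Rightarrow> 'y pmf) \<Rightarrow> ('x \<Rightarrow> 'y \<Rightarrow> real) \<Rightarrow> real \<Rightarrow> ('x \<Rightarrow> 'y pmf) \<Rightarrow> bool" where
  "kl_optimal D ref R \<beta> \<pi> \<longleftrightarrow> is_arg_max (kl_objective D ref R \<beta>) (kl_feasible D ref R \<beta>) \<pi>"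

end

theory Submission imports Defs begin

text \<open>
  Let \<open>g = \<pi>\<^sup>*\<close> be the Gibbs policy. At each prompt, the variational identity
  \<open>E\<^sub>p R - \<beta> KL(p \<parallel> ref) = \<beta> ln Z - \<beta> KL(p \<parallel> g)\<close> bounds the KL-regularised objective by \<open>\<beta> ln Z\<close>,
  attained at \<open>p = g\<close> only. The policy \<open>g\<close> itself may be infeasible (its mean reward can diverge),
  but conditioning \<open>g\<close> on large finite sets approaches the bound, so a feasible policy that differs
  from \<open>g\<close> at some prompt can always be improved there.

  For the loss, the implicit reward of \<open>g\<close> is \<open>R\<close>, so the minimum is \<open>0\<close>. Conversely a policy of zero
  loss has implicit reward \<open>R + c(x)\<close>, hence is proportional to \<open>g\<close> at each prompt, hence equal to it.
\<close>

section \<open>Mass functions: total mass, normalisation, finite approximation\<close>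

lemma has_sum_pmf: "(pmf p has_sum 1) UNIV"
proof -
  have "Infinite_Sum.abs_summable_on (pmf p) UNIV"
    unfolding abs_summable_equivalent by (rule pmf_abs_summable)
  hence "pmf p summable_on UNIV"
    by (rule abs_summable_summable)
  moreover have "infsum (pmf p) UNIV = 1"
    by (subst infsetsum_infsum[symmetric]) (auto simp: infsetsum_pmf_eq_1)
  ultimately show ?thesis
    by (simp add: has_sum_iff)
qed

text \<open>Turns the weights \<open>pmf (ref x) y * exp (R x y / \<beta>)\<close> into the Gibbs
  policy. Their sum is the partition function.\<close>

lemma exists_pmf_of_weights:
  fixes w :: "'a \<Rightarrow> real"
  assumes nonneg: "\<And>y. 0 \<le> w y" and summable: "w summable_on UNIV" and pos: "0 < infsum w UNIV"
  shows "\<exists>p. \<forall>y. pmf p y = w y / infsum w UNIV"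
proof -
  let ?v = "\<lambda>y. w y / infsum w UNIV"
  have "Infinite_Sum.abs_summable_on w UNIV"
    by (rule iffD1[OF summable_on_iff_abs_summable_on_real]) (rule summable)
  hence abs: "Infinite_Set_Sum.abs_summable_on w UNIV"
    unfolding abs_summable_equivalent .
  have absv: "Infinite_Set_Sum.abs_summable_on ?v UNIV"
    unfolding divide_inverse by (rule abs_summable_on_cmult_left) (rule abs)
  have "infsetsum ?v UNIV = 1"
  proof -
    have "infsetsum ?v UNIV = infsetsum w UNIV / infsum w UNIV"
      by (rule infsetsum_cdiv) (rule abs)
    also have "infsetsum w UNIV = infsum w UNIV"
      by (rule infsetsum_infsum) (rule abs)
    finally show ?thesis using pos by (metis divide_self less_irrefl)
  qed
  moreover have "0 \<le> ?v y" for y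
    using nonneg pos by (simp add: less_imp_le)
  ultimately have "(\<integral>\<^sup>+y. ennreal (?v y) \<partial>count_space UNIV) = 1"
    by (subst nn_integral_conv_infsetsum[OF absv]) auto
  hence "pmf (embed_pmf ?v) y = ?v y" for y
    using nonneg pos by (intro pmf_embed_pmf) auto
  thus ?thesis by blast
qed

text \<open>Finite partial sums of \<open>pmf p\<close> converge to 1, so they eventually exceed
  \<open>c\<close>. Finiteness of \<open>A\<close> matters later, since every function is integrable
  under a law with finite support.\<close>

lemma pmf_finite_approx:
  fixes p :: "'a pmf"
  assumes "c < 1"
  shows "\<exists>A. finite A \<and> c < measure_pmf.prob p A"
proof -
  have "(sum (pmf p) \<longlongrightarrow> 1) (finite_subsets_at_top UNIV)"
    using has_sum_pmf[of p] by (simp add: has_sum_def)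
  hence "\<forall>\<^sub>F A in finite_subsets_at_top UNIV. c < sum (pmf p) A"
    using assms by (rule order_tendstoD)
  moreover have "\<forall>\<^sub>F A in finite_subsets_at_top (UNIV :: 'a set). finite A"
    by (rule eventually_finite_subsets_at_top_weakI) auto
  ultimately have "\<forall>\<^sub>F A in finite_subsets_at_top UNIV. finite A \<and> c < sum (pmf p) A"
    by eventually_elim auto
  from eventually_happens'[OF finite_subsets_at_top_neq_bot this]
  obtain A where "finite A" "c < sum (pmf p) A" by blast
  thus ?thesis by (intro exI[of _ A]) (simp add: measure_measure_pmf_finite)
qed

text \<open>Both functions have total mass 1, which forces \<open>k = 1\<close>. This removes the
  unknown factor left when rewards agree only up to an additive constant.\<close>

lemma pmf_eq_of_proportional:
  assumes "\<And>y. pmf p y = k * pmf q y"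
  shows "p = q"
proof -
  have "((\<lambda>y. k * pmf q y) has_sum k * 1) UNIV"
    by (intro has_sum_cmult_right has_sum_pmf)
  moreover have "pmf p = (\<lambda>y. k * pmf q y)"
    using assms by (rule ext)
  ultimately have "(pmf p has_sum k) UNIV"
    by simp
  hence "k = 1"
    using has_sum_pmf[of p] infsumI by metis
  thus ?thesis using assms by (intro pmf_eqI) simp
qed

section \<open>Relative entropy of discrete laws and the Gibbs variational identity\<close>

lemma measure_pmf_eq_density:
  assumes "set_pmf p \<subseteq> set_pmf r"
  shows "measure_pmf p = density (measure_pmf r) (\<lambda>y. ennreal (pmf p y / pmf r y))"
proof (rule measure_eqI)
  fix A
  have eq: "ennreal (pmf r y) * (ennreal (pmf p y / pmf r y) * indicator A y)
      = ennreal (pmf p y) * indicator A y" for y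
  proof (cases "y \<in> set_pmf r")
    case True
    thus ?thesis
      by (simp add: mult.assoc[symmetric] ennreal_mult'[symmetric] pmf_eq_0_set_pmf)
  next
    case False
    \<comment> \<open>Off the support of \<open>r\<close> the quotient is \<open>0 / 0 = 0\<close>.
      This is consistent, because the support inclusion makes \<open>pmf p y\<close> vanish
      too.\<close>
    hence "pmf r y = 0" "pmf p y = 0" using assms by (auto simp: pmf_eq_0_set_pmf)
    thus ?thesis by simp
  qed
  have "emeasure (density (measure_pmf r) (\<lambda>y. ennreal (pmf p y / pmf r y))) A
      = (\<integral>\<^sup>+y. ennreal (pmf p y) * indicator A y \<partial>count_space UNIV)"
    by (simp add: emeasure_density nn_integral_measure_pmf eq)
  also have "\<dots> = (\<integral>\<^sup>+y. indicator A y \<partial>measure_pmf p)"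
    by (simp add: nn_integral_measure_pmf)
  finally show "emeasure (measure_pmf p) A
      = emeasure (density (measure_pmf r) (\<lambda>y. ennreal (pmf p y / pmf r y))) A"
    by simp
qed simp

text \<open>A Radon-Nikodym derivative is unique only almost everywhere, but for the discrete law
  \<open>r\<close> that means at every point of its support, so the formula holds pointwise
  there.\<close>

lemma entropy_density_pmf:
  assumes "set_pmf p \<subseteq> set_pmf r" and "y \<in> set_pmf p"
  shows "entropy_density b (measure_pmf r) (measure_pmf p) y = log b (pmf p y / pmf r y)"
proof -
  have "AE y in measure_pmf r. ennreal (pmf p y / pmf r y) = RN_deriv (measure_pmf r) (measure_pmf p) y"
    by (rule RN_deriv_unique_sigma_finite[OF _ measure_pmf_eq_density[OF assms(1), symmetric]])
       (auto intro: measure_pmf.sigma_finite_measure_axioms)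
  hence "RN_deriv (measure_pmf r) (measure_pmf p) y = ennreal (pmf p y / pmf r y)"
    using assms by (auto simp: AE_measure_pmf_iff)
  thus ?thesis by (simp add: entropy_density_def)
qed

text \<open>Strict positivity is available for a real density with respect to \<open>r\<close>.
  Integrability of the log ratio under \<open>p\<close> therefore becomes integrability of ratio
  times log ratio under \<open>r\<close>.\<close>

lemma KL_pmf_gt_0:
  assumes ac: "set_pmf p \<subseteq> set_pmf r" and b: "1 < b"
    and int: "integrable (measure_pmf p) (entropy_density b (measure_pmf r) (measure_pmf p))"
    and neq: "p \<noteq> r"
  shows "0 < KL_divergence b (measure_pmf r) (measure_pmf p)"
proof -
  interpret information_space "measure_pmf r" b
    by unfold_locales (rule b)
  let ?D = "\<lambda>y. pmf p y / pmf r y"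
  have D: "measure_pmf p = density (measure_pmf r) ?D"
    by (rule measure_pmf_eq_density[OF ac])
  have "integrable (measure_pmf p) (\<lambda>y. log b (?D y))"
    using int by (rule integrable_cong_AE_imp)
      (auto simp: AE_measure_pmf_iff entropy_density_pmf[OF ac])
  hence "integrable (measure_pmf r) (\<lambda>y. ?D y * log b (?D y))"
    unfolding D by (subst (asm) integrable_real_density) auto
  moreover have "density (measure_pmf r) ?D \<noteq> measure_pmf r"
    using neq D by (metis measure_pmf_inject)
  moreover have "prob_space (density (measure_pmf r) ?D)"
    using D measure_pmf.prob_space_axioms by metis
  ultimately show ?thesis
    unfolding D by (intro KL_gt_0) auto
qed

text \<open>On the support of \<open>p\<close>,
  \<open>ln (p/g) = ln (p/r) - f / \<beta> + ln Z\<close>. Averaging over \<open>p\<close> gives the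
  identity; integrability of both \<open>f\<close> and the log ratio allows the average to be
  split.\<close>

lemma gibbs_variational:
  fixes f :: "'a \<Rightarrow> real"
  assumes \<beta>: "\<beta> > 0" and Z: "Z > 0"
    and g: "\<And>y. pmf g y = 1 / Z * pmf r y * exp (f y / \<beta>)"
    and ac: "set_pmf p \<subseteq> set_pmf r"
    and f: "integrable (measure_pmf p) f"
    and int: "integrable (measure_pmf p) (entropy_density (exp 1) (measure_pmf r) (measure_pmf p))"
  shows "integrable (measure_pmf p) (entropy_density (exp 1) (measure_pmf g) (measure_pmf p))"
    and "measure_pmf.expectation p f - \<beta> * KL_divergence (exp 1) (measure_pmf r) (measure_pmf p)
      = \<beta> * ln Z - \<beta> * KL_divergence (exp 1) (measure_pmf g) (measure_pmf p)"
proof -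
  let ?er = "entropy_density (exp 1) (measure_pmf r) (measure_pmf p)"
  let ?eg = "entropy_density (exp 1) (measure_pmf g) (measure_pmf p)"
  have "set_pmf g = set_pmf r"
    using Z by (auto simp: set_pmf_eq g)
  hence ac': "set_pmf p \<subseteq> set_pmf g" using ac by simp
  have eq: "?eg y = ?er y - f y / \<beta> + ln Z" if y: "y \<in> set_pmf p" for y
  proof -
    have pos: "pmf p y > 0" "pmf r y > 0"
      using y ac by (auto simp: pmf_positive)
    have "ln (pmf p y / pmf g y) = ln (pmf p y / pmf r y) - f y / \<beta> + ln Z"
      using pos Z by (simp add: g ln_div ln_mult)
    thus ?thesis
      by (simp add: entropy_density_pmf[OF ac y] entropy_density_pmf[OF ac' y] log_ln[symmetric])
  qed
  have AE: "AE y in measure_pmf p. ?eg y = ?er y - f y / \<beta> + ln Z"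
    using eq by (simp add: AE_measure_pmf_iff)
  have int': "integrable (measure_pmf p) (\<lambda>y. ?er y - f y / \<beta> + ln Z)"
    using f int by auto
  show "integrable (measure_pmf p) ?eg"
    using int' by (rule integrable_cong_AE_imp) (use AE in auto)
  have "KL_divergence (exp 1) (measure_pmf g) (measure_pmf p)
      = measure_pmf.expectation p (\<lambda>y. ?er y - f y / \<beta> + ln Z)"
    unfolding KL_divergence_def by (rule integral_cong_AE) (use AE in auto)
  also have "\<dots> = KL_divergence (exp 1) (measure_pmf r) (measure_pmf p)
      - measure_pmf.expectation p f / \<beta> + ln Z"
    unfolding KL_divergence_def using f int by simp
  finally show "measure_pmf.expectation p f - \<beta> * KL_divergence (exp 1) (measure_pmf r) (measure_pmf p)
      = \<beta> * ln Z - \<beta> * KL_divergence (exp 1) (measure_pmf g) (measure_pmf p)"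
    using \<beta> by (simp add: field_simps)
qed

text \<open>On its support the conditioned law is \<open>g\<close> divided by the mass of
  \<open>A\<close>, so the log ratio is constant.\<close>

lemma KL_cond_pmf:
  assumes "set_pmf g \<inter> A \<noteq> {}"
  shows "KL_divergence (exp 1) (measure_pmf g) (measure_pmf (cond_pmf g A))
    = - ln (measure_pmf.prob g A)"
proof -
  let ?q = "cond_pmf g A"
  have q: "set_pmf ?q = set_pmf g \<inter> A"
    using assms by simp
  have "entropy_density (exp 1) (measure_pmf g) (measure_pmf ?q) y = - ln (measure_pmf.prob g A)"
    if y: "y \<in> set_pmf ?q" for y
  proof -
    have "y \<in> A" "pmf g y > 0" using y q by (auto simp: pmf_positive)
    \<comment> \<open>This makes the mass of \<open>A\<close> positive, as splitting the logarithm
      requires.\<close>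
    moreover have "pmf g y \<le> measure_pmf.prob g A"
      using \<open>y \<in> A\<close> measure_pmf.finite_measure_mono[of "{y}" A g] by (simp add: measure_pmf_single)
    ultimately show ?thesis
      using y q assms by (simp add: entropy_density_pmf log_ln[symmetric] pmf_cond ln_div)
  qed
  hence "KL_divergence (exp 1) (measure_pmf g) (measure_pmf ?q)
      = measure_pmf.expectation ?q (\<lambda>_. - ln (measure_pmf.prob g A))"
    unfolding KL_divergence_def by (intro integral_cong_AE) (auto simp: AE_measure_pmf_iff)
  thus ?thesis by simp
qed

section \<open>Maximisers of the KL-regularised objective\<close>

lemma integrable_measure_pmf_modify_point:
  fixes h k :: "'a \<Rightarrow> real"
  assumes "integrable (measure_pmf D) h" and "\<And>x. x \<noteq> a \<Longrightarrow> k x = h x"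
  shows "integrable (measure_pmf D) k"
    and "measure_pmf.expectation D k = measure_pmf.expectation D h + pmf D a * (k a - h a)"
proof -
  \<comment> \<open>A change at one point adds a multiple of its indicator, whose integral is the
    point mass.\<close>
  have k: "k = (\<lambda>x. h x + (k a - h a) * indicator {a} x)"
    using assms(2) by (auto simp: fun_eq_iff indicator_def)
  show "integrable (measure_pmf D) k"
    by (subst k, intro Bochner_Integration.integrable_add assms(1) integrable_mult_right)
       (simp add: integrable_indicator_iff less_top[symmetric])
  have "measure_pmf.expectation D k
      = measure_pmf.expectation D (\<lambda>x. h x + (k a - h a) * indicator {a} x)"
    using k by (rule arg_cong)
  also have "\<dots> = measure_pmf.expectation D h + pmf D a * (k a - h a)"
    using assms(1)
    by (subst Bochner_Integration.integral_add)
       (simp_all add: integrable_indicator_iff less_top[symmetric] measure_pmf_single)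
  finally show "measure_pmf.expectation D k = measure_pmf.expectation D h + pmf D a * (k a - h a)" .
qed

text \<open>Feasibility supplies, at the prompt \<open>x\<close>, the support inclusion and
  integrability required by the variational identity. Strictness is positivity of the divergence
  from \<open>g x\<close>.\<close>

lemma kl_value_gibbs:
  assumes "\<beta> > 0" and "Z > 0" and x: "x \<in> set_pmf D"
    and "\<And>y. pmf (g x) y = 1 / Z * pmf (ref x) y * exp (R x y / \<beta>)"
    and feas: "kl_feasible D ref R \<beta> \<pi>"
  shows "kl_value ref R \<beta> \<pi> x
      = \<beta> * ln Z - \<beta> * KL_divergence (exp 1) (measure_pmf (g x)) (measure_pmf (\<pi> x))"
    and "\<pi> x \<noteq> g x \<Longrightarrow> kl_value ref R \<beta> \<pi> x < \<beta> * ln Z"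
proof -
  have ac: "set_pmf (\<pi> x) \<subseteq> set_pmf (ref x)"
    using feas x by (auto simp: kl_feasible_def candidate_policy_def)
  have "set_pmf (g x) = set_pmf (ref x)"
    using assms(2,4) by (auto simp: set_pmf_eq)
  hence ac': "set_pmf (\<pi> x) \<subseteq> set_pmf (g x)" using ac by simp
  note V = gibbs_variational[of \<beta> Z "g x" "ref x" "R x" "\<pi> x", OF assms(1,2,4) ac]
  show eq: "kl_value ref R \<beta> \<pi> x
      = \<beta> * ln Z - \<beta> * KL_divergence (exp 1) (measure_pmf (g x)) (measure_pmf (\<pi> x))"
    unfolding kl_value_def using feas x by (intro V(2)) (auto simp: kl_feasible_def)
  assume "\<pi> x \<noteq> g x"
  moreover have "integrable (measure_pmf (\<pi> x))
      (entropy_density (exp 1) (measure_pmf (g x)) (measure_pmf (\<pi> x)))"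
    using feas x by (intro V(1)) (auto simp: kl_feasible_def)
  ultimately have "0 < KL_divergence (exp 1) (measure_pmf (g x)) (measure_pmf (\<pi> x))"
    using ac' by (intro KL_pmf_gt_0) auto
  thus "kl_value ref R \<beta> \<pi> x < \<beta> * ln Z"
    using eq assms(1) by simp
qed

text \<open>Only the prompt \<open>a\<close> is changed. The new response law is \<open>g a\<close>
  conditioned on a finite set \<open>A\<close>: finite support keeps it feasible, and its value
  falls short of \<beta> ln Z by only -\<beta> ln P(A).\<close>

lemma kl_feasible_improve:
  fixes g :: "'x \<Rightarrow> 'y pmf"
  assumes \<beta>: "\<beta> > 0" and Z: "Z > 0" and a: "a \<in> set_pmf D"
    and g: "\<And>y. pmf (g a) y = 1 / Z * pmf (ref a) y * exp (R a y / \<beta>)"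
    and feas: "kl_feasible D ref R \<beta> \<pi>" and neq: "\<pi> a \<noteq> g a"
  shows "\<exists>\<pi>'. kl_feasible D ref R \<beta> \<pi>' \<and> kl_objective D ref R \<beta> \<pi> < kl_objective D ref R \<beta> \<pi>'"
proof -
  let ?v = "kl_value ref R \<beta> \<pi> a"
  have gap: "?v < \<beta> * ln Z"
    by (rule kl_value_gibbs(2)[where g = g, OF \<beta> Z a g feas neq])
  hence "?v / \<beta> - ln Z < 0"
    using \<beta> by (simp add: field_simps)
  \<comment> \<open>This threshold is the mass of \<open>A\<close> at which \<beta> (ln Z + ln P(A))
    equals the current value \<open>?v\<close>; any larger mass is an improvement.\<close>
  hence "exp (?v / \<beta> - ln Z) < 1" by simp
  then obtain A where A: "finite A" "exp (?v / \<beta> - ln Z) < measure_pmf.prob (g a) A"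
    using pmf_finite_approx by blast
  have ne: "set_pmf (g a) \<inter> A \<noteq> {}"
  proof
    assume "set_pmf (g a) \<inter> A = {}"
    hence "measure_pmf.prob (g a) A = 0" by (simp add: measure_pmf_zero_iff)
    thus False using A(2) exp_gt_zero[of "?v / \<beta> - ln Z"] by linarith
  qed
  define q where "q = cond_pmf (g a) A"
  define \<pi>' where "\<pi>' = \<pi>(a := q)"
  have qset: "set_pmf q = set_pmf (g a) \<inter> A"
    using ne by (simp add: q_def)
  hence fin: "finite (set_pmf q)" using A by simp
  have ac: "set_pmf q \<subseteq> set_pmf (ref a)"
    using qset g by (auto simp: set_pmf_eq)
  have "\<beta> * ln Z - \<beta> * KL_divergence (exp 1) (measure_pmf (g a)) (measure_pmf q)
      = \<beta> * (ln Z + ln (measure_pmf.prob (g a) A))"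
    using KL_cond_pmf[OF ne] by (simp add: q_def algebra_simps)
  moreover have "kl_value ref R \<beta> \<pi>' a
      = \<beta> * ln Z - \<beta> * KL_divergence (exp 1) (measure_pmf (g a)) (measure_pmf q)"
    using gibbs_variational(2)[of \<beta> Z "g a" "ref a" "R a" q, OF \<beta> Z g ac] fin
    by (simp add: kl_value_def \<pi>'_def integrable_measure_pmf_finite)
  moreover have "?v < \<beta> * (ln Z + ln (measure_pmf.prob (g a) A))"
  proof -
    have "?v / \<beta> - ln Z < ln (measure_pmf.prob (g a) A)"
      using A(2) by (subst exp_less_cancel_iff[symmetric]) (simp add: less_trans[OF exp_gt_zero A(2)])
    thus ?thesis using \<beta> by (simp add: field_simps)
  qed
  ultimately have better: "?v < kl_value ref R \<beta> \<pi>' a" by simp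
  have same: "kl_value ref R \<beta> \<pi>' x = kl_value ref R \<beta> \<pi> x" if "x \<noteq> a" for x
    using that by (simp add: kl_value_def \<pi>'_def)
  have intD: "integrable (measure_pmf D) (kl_value ref R \<beta> \<pi>)"
    using feas by (simp add: kl_feasible_def)
  note M = integrable_measure_pmf_modify_point[OF intD same]
  have "kl_feasible D ref R \<beta> \<pi>'"
    using feas fin ac M(1)
    by (auto simp: kl_feasible_def candidate_policy_def \<pi>'_def integrable_measure_pmf_finite)
  \<comment> \<open>The gain at \<open>a\<close> enters with weight \<open>pmf D a\<close>, which is
    positive because \<open>a\<close> occurs.\<close>
  moreover have "kl_objective D ref R \<beta> \<pi> < kl_objective D ref R \<beta> \<pi>'"
    unfolding kl_objective_def using M(2) better a by (simp add: pmf_positive)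
  ultimately show ?thesis by blast
qed

text \<open>An optimum differing from \<open>g\<close> at an occurring prompt could be improved
  there; conversely \<open>g\<close> attains the pointwise bound \<beta> ln Z. Feasibility stays on
  the right because \<open>g\<close> may be infeasible, and then no optimum exists.\<close>

lemma kl_optimal_iff_gibbs:
  assumes \<beta>: "\<beta> > 0" and Z: "\<And>x. x \<in> set_pmf D \<Longrightarrow> Z x > 0"
    and g: "\<And>x y. x \<in> set_pmf D \<Longrightarrow> pmf (g x) y = 1 / Z x * pmf (ref x) y * exp (R x y / \<beta>)"
  shows "kl_optimal D ref R \<beta> \<pi> \<longleftrightarrow> kl_feasible D ref R \<beta> \<pi> \<and> (\<forall>x\<in>set_pmf D. \<pi> x = g x)"
proof (intro iffI conjI ballI)
  assume opt: "kl_optimal D ref R \<beta> \<pi>"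
  thus feas: "kl_feasible D ref R \<beta> \<pi>"
    by (simp add: kl_optimal_def is_arg_max_def)
  fix x assume x: "x \<in> set_pmf D"
  show "\<pi> x = g x"
    using kl_feasible_improve[where g = g, OF \<beta> Z[OF x] x g[OF x] feas] opt
    by (auto simp: kl_optimal_def is_arg_max_def)
next
  assume "kl_feasible D ref R \<beta> \<pi> \<and> (\<forall>x\<in>set_pmf D. \<pi> x = g x)"
  hence feas: "kl_feasible D ref R \<beta> \<pi>" and eq: "\<And>x. x \<in> set_pmf D \<Longrightarrow> \<pi> x = g x" by auto
  have "kl_objective D ref R \<beta> \<pi>' \<le> kl_objective D ref R \<beta> \<pi>" if feas': "kl_feasible D ref R \<beta> \<pi>'" for \<pi>'
    unfolding kl_objective_def
  proof (rule integral_mono_AE)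
    show "AE x in measure_pmf D. kl_value ref R \<beta> \<pi>' x \<le> kl_value ref R \<beta> \<pi> x"
      unfolding AE_measure_pmf_iff
    proof
      fix x assume x: "x \<in> set_pmf D"
      note V = kl_value_gibbs[where g = g and ref = ref and R = R and x = x, OF \<beta> Z[OF x] x g[OF x]]
      note KL_same = sigma_finite_measure.KL_same_eq_0[OF measure_pmf.sigma_finite_measure_axioms]
      have "kl_value ref R \<beta> \<pi> x = \<beta> * ln (Z x)"
        using V(1)[OF feas] eq[OF x] by (simp add: KL_same)
      \<comment> \<open>The strict bound applies only when \<open>\<pi>' x\<close> differs from
        \<open>g x\<close>; otherwise the two values coincide.\<close>
      thus "kl_value ref R \<beta> \<pi>' x \<le> kl_value ref R \<beta> \<pi> x"
        using V[OF feas'] by (cases "\<pi>' x = g x") (simp_all add: KL_same)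
    qed
  qed (use feas feas' in \<open>auto simp: kl_feasible_def\<close>)
  thus "kl_optimal D ref R \<beta> \<pi>"
    using feas by (auto simp: kl_optimal_def is_arg_max_def not_less)
qed

section \<open>Minimisers of the GVPO loss\<close>

lemma gvpo_loss_gibbs:
  assumes \<beta>: "\<beta> > 0" and Z: "\<And>x. x \<in> set_pmf D \<Longrightarrow> partition_fn ref R \<beta> x > 0"
    and \<pi>: "\<And>x y. x \<in> set_pmf D \<Longrightarrow>
      pmf (\<pi> x) y = 1 / partition_fn ref R \<beta> x * pmf (ref x) y * exp (R x y / \<beta>)"
    and R: "\<And>x. x \<in> set_pmf D \<Longrightarrow> integrable (measure_pmf (ref x)) (R x)"
  shows "gvpo_loss D ref ref R \<beta> \<pi> = 0"
proof -
  \<comment> \<open>The two \<open>ln Z\<close> terms cancel. Equality on the support of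
    \<open>ref x\<close> suffices, since the rest is a null set for the sampling law.\<close>
  have rew: "implicit_reward ref R \<beta> \<pi> x y = R x y"
    if x: "x \<in> set_pmf D" and y: "y \<in> set_pmf (ref x)" for x y
    using \<beta> Z[OF x] pmf_positive[OF y]
    by (simp add: implicit_reward_def \<pi>[OF x] ln_div field_simps)
  have fin: "implicit_reward_mean_finite D ref ref R \<beta> \<pi>"
    unfolding implicit_reward_mean_finite_def
  proof (intro ballI conjI)
    fix x assume x: "x \<in> set_pmf D"
    show "set_pmf (ref x) \<subseteq> set_pmf (\<pi> x)"
      using Z[OF x] by (auto simp: set_pmf_eq \<pi>[OF x])
    show "integrable (measure_pmf (ref x)) (implicit_reward ref R \<beta> \<pi> x)"
      using R[OF x] by (rule integrable_cong_AE_imp) (auto simp: AE_measure_pmf_iff rew[OF x])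
  qed
  have "measure_pmf.expectation (ref x) (implicit_reward ref R \<beta> \<pi> x) = measure_pmf.expectation (ref x) (R x)"
    if x: "x \<in> set_pmf D" for x
    by (rule integral_cong_AE) (auto simp: AE_measure_pmf_iff rew[OF x])
  thus ?thesis
    using fin by (simp add: gvpo_loss_def nn_integral_0_iff_AE AE_measure_pmf_iff rew)
qed

text \<open>A vanishing integral of squares under discrete laws makes the centred rewards agree at
  every sampled response. Only the difference \<open>c\<close> of the means is undetermined, and
  normalisation fixes it.\<close>

lemma gvpo_loss_eq_0_imp_gibbs:
  assumes \<beta>: "\<beta> > 0" and x: "x \<in> set_pmf D" and Z: "partition_fn ref R \<beta> x > 0"
    and g: "\<And>y. pmf g y = 1 / partition_fn ref R \<beta> x * pmf (ref x) y * exp (R x y / \<beta>)"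
    and cand: "candidate_policy D ref \<pi>" and loss: "gvpo_loss D ref ref R \<beta> \<pi> = 0"
  shows "\<pi> x = g"
proof -
  let ?Z = "partition_fn ref R \<beta> x"
  define c where "c = measure_pmf.expectation (ref x) (implicit_reward ref R \<beta> \<pi> x)
    - measure_pmf.expectation (ref x) (R x)"
  \<comment> \<open>Loss 0 excludes the infinite branch. The support inclusion contained in this
    condition, with candidacy, then makes the supports equal, so the logarithms can be
    inverted.\<close>
  have fin: "implicit_reward_mean_finite D ref ref R \<beta> \<pi>"
    using loss by (auto simp: gvpo_loss_def split: if_splits)
  hence "set_pmf (ref x) \<subseteq> set_pmf (\<pi> x)"
    using x by (simp add: implicit_reward_mean_finite_def)
  hence supp: "set_pmf (\<pi> x) = set_pmf (ref x)"
    using cand x by (auto simp: candidate_policy_def)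
  have rew: "implicit_reward ref R \<beta> \<pi> x y = R x y + c" if y: "y \<in> set_pmf (ref x)" for y
  proof -
    have "implicit_reward ref R \<beta> \<pi> x y
        - measure_pmf.expectation (ref x) (implicit_reward ref R \<beta> \<pi> x)
        = R x y - measure_pmf.expectation (ref x) (R x)"
      using loss fin x y by (auto simp: gvpo_loss_def nn_integral_0_iff_AE AE_measure_pmf_iff)
    thus ?thesis by (simp add: c_def)
  qed
  \<comment> \<open>Exponentiating turns the additive constant \<open>c\<close> into the factor
    \<open>exp (c / \<beta>)\<close>.\<close>
  have "pmf (\<pi> x) y = exp (c / \<beta>) * pmf g y" for y
  proof (cases "y \<in> set_pmf (ref x)")
    case True
    hence pos: "pmf (ref x) y > 0" "pmf (\<pi> x) y > 0"
      using supp by (auto simp: pmf_positive)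
    have "\<beta> * ln (pmf (\<pi> x) y / pmf (ref x) y) = R x y + c - \<beta> * ln ?Z"
      using rew[OF True] by (simp add: implicit_reward_def)
    hence "ln (pmf (\<pi> x) y / pmf (ref x) y) = R x y / \<beta> + c / \<beta> - ln ?Z"
      using \<beta> by (simp add: field_simps)
    hence "pmf (\<pi> x) y / pmf (ref x) y = exp (R x y / \<beta> + c / \<beta> - ln ?Z)"
      using pos by (metis divide_pos_pos exp_ln)
    thus ?thesis
      using pos Z by (simp add: g exp_add exp_diff field_simps)
  next
    case False
    hence "pmf (ref x) y = 0" "pmf (\<pi> x) y = 0"
      using supp by (auto simp: set_pmf_eq)
    thus ?thesis by (simp add: g)
  qed
  thus ?thesis by (rule pmf_eq_of_proportional)
qed

theorem theorem3p1:
  fixes D :: "'x pmf" and s ref :: "'x \<Rightarrow> 'y pmf"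
    and R :: "'x \<Rightarrow> 'y \<Rightarrow> real" and \<beta> :: real
  assumes "\<beta> > 0"
    and "\<And>x. x \<in> set_pmf D \<Longrightarrow> (\<lambda>y. pmf (ref x) y * exp (R x y / \<beta>)) summable_on UNIV"
    and "\<And>x. x \<in> set_pmf D \<Longrightarrow> integrable (measure_pmf (s x)) (R x)"
    and "s = ref"
  shows "\<exists>\<pi>\<^sub>s\<^sub>t\<^sub>a\<^sub>r :: 'x \<Rightarrow> 'y pmf.
      (\<forall>x\<in>set_pmf D. \<forall>y.
         pmf (\<pi>\<^sub>s\<^sub>t\<^sub>a\<^sub>r x) y = 1 / partition_fn ref R \<beta> x * pmf (ref x) y * exp (R x y / \<beta>)) \<and>
      (\<forall>\<pi>. kl_optimal D ref R \<beta> \<pi> \<longleftrightarrow>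
         kl_feasible D ref R \<beta> \<pi> \<and> (\<forall>x\<in>set_pmf D. \<pi> x = \<pi>\<^sub>s\<^sub>t\<^sub>a\<^sub>r x)) \<and>
      (\<forall>\<pi>. is_arg_min (gvpo_loss D s ref R \<beta>) (candidate_policy D ref) \<pi> \<longleftrightarrow>
         (\<forall>x\<in>set_pmf D. \<pi> x = \<pi>\<^sub>s\<^sub>t\<^sub>a\<^sub>r x))"
proof -
  let ?Z = "partition_fn ref R \<beta>"
  let ?w = "\<lambda>x y. pmf (ref x) y * exp (R x y / \<beta>)"
  note R = assms(3)[unfolded assms(4)]
  \<comment> \<open>A single positive term bounds the sum of nonnegative terms from below.\<close>
  have Z: "?Z x > 0" if x: "x \<in> set_pmf D" for x
  proof -
    obtain y where "y \<in> set_pmf (ref x)"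
      using set_pmf_not_empty[of "ref x"] by blast
    hence "0 < ?w x y" by (simp add: pmf_positive)
    also have "?w x y = infsum (?w x) {y}" by simp
    also have "\<dots> \<le> infsum (?w x) UNIV"
      using assms(2)[OF x] by (intro infsum_mono_neutral) auto
    finally show ?thesis by (simp add: partition_fn_def)
  qed
  have "\<exists>g. \<forall>y. pmf g y = 1 / ?Z x * pmf (ref x) y * exp (R x y / \<beta>)" if x: "x \<in> set_pmf D" for x
    using exists_pmf_of_weights[OF _ assms(2)[OF x]] Z[OF x] by (simp add: partition_fn_def)
  \<comment> \<open>Laws are chosen prompt by prompt; \<open>g\<close> is arbitrary at prompts
    outside the support of \<open>D\<close>.\<close>
  then obtain g where
    g: "\<And>x y. x \<in> set_pmf D \<Longrightarrow> pmf (g x) y = 1 / ?Z x * pmf (ref x) y * exp (R x y / \<beta>)"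
    by metis
  have min: "is_arg_min (gvpo_loss D s ref R \<beta>) (candidate_policy D ref) \<pi>
      \<longleftrightarrow> (\<forall>x\<in>set_pmf D. \<pi> x = g x)" for \<pi>
  proof
    have "candidate_policy D ref g"
      by (auto simp: candidate_policy_def set_pmf_eq g)
    moreover have "gvpo_loss D ref ref R \<beta> g = 0"
      using assms(1) Z g R by (rule gvpo_loss_gibbs)
    moreover assume "is_arg_min (gvpo_loss D s ref R \<beta>) (candidate_policy D ref) \<pi>"
    \<comment> \<open>The candidate \<open>g\<close> attains 0, the least value of
      \<open>ennreal\<close>, so every minimiser has loss 0.\<close>
    ultimately have "candidate_policy D ref \<pi>" "gvpo_loss D ref ref R \<beta> \<pi> = 0"
      unfolding assms(4) is_arg_min_def by (auto simp: zero_less_iff_neq_zero)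
    thus "\<forall>x\<in>set_pmf D. \<pi> x = g x"
      using gvpo_loss_eq_0_imp_gibbs[OF assms(1) _ Z g] by auto
  next
    assume eq: "\<forall>x\<in>set_pmf D. \<pi> x = g x"
    hence "gvpo_loss D ref ref R \<beta> \<pi> = 0"
      using g by (intro gvpo_loss_gibbs assms(1) Z R) auto
    moreover have "candidate_policy D ref \<pi>"
      using eq by (auto simp: candidate_policy_def set_pmf_eq g)
    ultimately show "is_arg_min (gvpo_loss D s ref R \<beta>) (candidate_policy D ref) \<pi>"
      unfolding assms(4) is_arg_min_def by simp
  qed
  have opt: "kl_optimal D ref R \<beta> \<pi> \<longleftrightarrow> kl_feasible D ref R \<beta> \<pi> \<and> (\<forall>x\<in>set_pmf D. \<pi> x = g x)" for \<pi>
    using assms(1) Z g by (rule kl_optimal_iff_gibbs)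
  show ?thesis
    by (intro exI[of _ g] conjI ballI allI g opt min)
qed

end
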